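(* For every integer $n\ge 0$: (i) $\overline{R}_8^{\ast}(4n+\xi)\equiv 0\pmod 4$ for each $\xi\in\{2,3\}$; (ii) $\overline{R}_8^{\ast}(16n+4\xi+1)\equiv 0\pmod 4$ for each $\xi\in\{1,2,3\}$.
   Context: An overpartition of a nonnegative integer $n$ is a partition of $n$ in which the first occurrence of each part size may be overlined. For a positive integer $\ell$, $\overline{R}_\ell^{\ast}(n)$ denotes the number of overpartitions of $n$ in which the non-overlined parts are $\ell$-regular, i.e. no non-overlined part is divisible by $\ell$ (overlined parts are unrestricted). With $f_h:=\prod_{m\ge 1}(1-q^{hm})$, the generating function is $\sum_{n\ge 0}\overline{R}_\ell^{\ast}(n)q^n=\frac{f_2f_\ell}{f_1^2}$. *)

theory Defs
  imports "HOL-Library.Multiset" "HOL-Number_Theory.Cong"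
begin

definition partitions :: "nat \<Rightarrow> nat multiset set" where
  "partitions n = {P. 0 \<notin># P \<and> \<Sum>\<^sub># P = n}"

text \<open>
  An overpartition is a pair \<open>(P, S)\<close>: \<open>P\<close> is the multiset of all parts, and \<open>S\<close> is the
  set of those part sizes whose first occurrence is overlined.
\<close>

definition overpartitions :: "nat \<Rightarrow> (nat multiset \<times> nat set) set" where
  "overpartitions n = {(P, S). P \<in> partitions n \<and> S \<subseteq> set_mset P}"

text \<open>One copy of each size in \<open>S\<close> is overlined; the remaining copies are not.\<close>

definition non_overlined :: "nat multiset \<times> nat set \<Rightarrow> nat multiset" where
  "non_overlined = (\<lambda>(P, S). P - mset_set S)"

definition regular :: "nat \<Rightarrow> nat multiset \<Rightarrow> bool" where
  "regular l P \<longleftrightarrow> (\<forall>m \<in># P. \<not> l dvd m)"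

definition R_star :: "nat \<Rightarrow> nat \<Rightarrow> nat" where
  "R_star l n = card {\<pi> \<in> overpartitions n. regular l (non_overlined \<pi>)}"

text \<open>Finiteness, so that the cardinality in \<open>R_star\<close> is a genuine count.\<close>

lemma finite_partitions: "finite (partitions n)"
proof (rule finite_subset)
  have size_le: "size P \<le> \<Sum>\<^sub># P" if "0 \<notin># P" for P :: "nat multiset"
    using that by (induction P) auto
  show "partitions n \<subseteq> mset ` {xs. set xs \<subseteq> {..n} \<and> length xs \<le> n}"
  proof
    fix P assume P: "P \<in> partitions n"
    obtain xs where xs: "P = mset xs" by (metis ex_mset)
    have "length xs \<le> n"
      using size_le[of P] P by (simp add: partitions_def xs)
    moreover have "set xs \<subseteq> {..n}"
      using P member_le_sum_list[of _ xs] by (auto simp: partitions_def xs sum_mset_sum_list)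
    ultimately show "P \<in> mset ` {xs. set xs \<subseteq> {..n} \<and> length xs \<le> n}"
      using xs by blast
  qed
qed (simp add: finite_lists_length_le)

lemma finite_overpartitions: "finite (overpartitions n)"
proof -
  have "overpartitions n = (SIGMA P:partitions n. Pow (set_mset P))"
    by (auto simp: overpartitions_def)
  then show ?thesis by (simp add: finite_partitions)
qed

end

theory Submission
  imports Defs "HOL-Library.Z2" "HOL-Computational_Algebra.Polynomial"
begin

text \<open>
  Fix the multiset \<open>P\<close> of parts and count the ways to overline it. A multiple of \<open>l\<close> may not occur
  non-overlined, so it must occur exactly once and be overlined; the overlining of each other part
  size is free. Hence \<open>R_star l n\<close> is the sum of \<open>2 ^ c(P)\<close> over the \<open>P\<close> whose multiples of \<open>l\<close> are
  distinct, where \<open>c(P)\<close> is the number of part sizes that are not multiples of \<open>l\<close>. If \<open>l\<close> does not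
  divide \<open>n\<close>, then \<open>c(P) = 0\<close> is impossible, so modulo 4 only the \<open>P\<close> with \<open>c(P) = 1\<close> count, each
  with weight 2. Such a \<open>P\<close> consists of a set \<open>B\<close> of multiples of \<open>l\<close> together with copies of a single
  size \<open>a\<close>, which can be any divisor of \<open>n - \<Sum>B\<close>. A positive number has an odd number of divisors
  iff it is a square, so \<open>R_star l n\<close> is divisible by 4 iff the number of sets \<open>B\<close> for which
  \<open>n - \<Sum>B\<close> is a square is even (\<open>R_star_cong_0_iff\<close>). In terms of generating functions this is
  \<open>f_2 f_l / f_1^2 = \<phi>(q) f_l\<close> modulo 4 with \<open>\<phi>(q) = 1 + 2 (q + q^4 + q^9 + ...)\<close>, away from the
  exponents divisible by \<open>l\<close>.
  
  For \<open>l = 8\<close>, \<open>n - \<Sum>B\<close> is congruent to \<open>n\<close> modulo 8, and squares are 0, 1 or 4 modulo 8. This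
  leaves no \<open>B\<close> at all in every case of the theorem but one, \<open>n mod 16 = 9\<close>. There the square is odd,
  hence eight times a triangular number plus one, and dividing by 8 turns the count into the number
  of ways to write an odd \<open>N\<close> as a sum of distinct parts plus a triangular number. That this is even
  follows from Gauss's identity
    \<open>1 + q + q^3 + q^6 + ... = \<Prod>(1 - q^(2k)) / \<Prod>(1 - q^(2k-1))\<close>.
  Multiplied by \<open>\<Prod>(1 - q^m)\<close>, which modulo 2 generates the partitions into distinct parts, the
  right-hand side becomes \<open>\<Prod>(1 - q^(2k))^2\<close>, a series in \<open>q^2\<close>. A finite form of Gauss's identity
  due to Shanks, with an error of order \<open>q^(2n+1)\<close>, suffices and has a proof by telescoping sums
  (\<open>gauss_triangular_finite\<close>).
\<close>

section \<open>A finite form of Gauss's identity for triangular numbers\<close>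

definition odd_factors :: "'a::comm_ring_1 \<Rightarrow> nat \<Rightarrow> 'a" where
  "odd_factors q n = (\<Prod>k<n. 1 - q ^ (2 * k + 1))"

definition even_factors :: "'a::comm_ring_1 \<Rightarrow> nat \<Rightarrow> nat \<Rightarrow> 'a" where
  "even_factors q s n = (\<Prod>k\<in>{s<..n}. 1 - q ^ (2 * k))"

lemma even_factors_same: "even_factors q n n = 1"
  by (simp add: even_factors_def)

lemma even_factors_Suc:
  assumes "s \<le> n"
  shows "even_factors q s (Suc n) = even_factors q s n * (1 - q ^ (2 * Suc n))"
proof -
  have "{s<..Suc n} = insert (Suc n) {s<..n}" using assms by auto
  then show ?thesis by (simp add: even_factors_def mult.commute)
qed

lemma even_factors_split_first:
  assumes "s < n"
  shows "even_factors q s n = (1 - q ^ (2 * Suc s)) * even_factors q (Suc s) n"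
proof -
  have "{s<..n} = insert (Suc s) {Suc s<..n}" using assms by auto
  then show ?thesis by (simp add: even_factors_def)
qed

text \<open>
  The term \<open>s = 0\<close> on the left is the truncated product \<open>\<Prod>(1 - q^(2k))\<close>, and the other terms are
  multiples of \<open>q^(2n+1)\<close>; thus the limit is Gauss's identity. Shanks divides by the odd factors;
  multiplying them out instead makes every term a polynomial, so that \<open>q\<close> may be an element
  of any commutative ring. In the induction on \<open>n\<close> the old identity is multiplied by the new odd
  factor, and the termwise difference of the two sums telescopes. The exponents \<open>\<Sum>{..j}\<close> are the
  triangular numbers.
\<close>

lemma gauss_triangular_finite:
  fixes q :: "'a::comm_ring_1"
  shows "(\<Sum>s\<le>n. odd_factors q s * even_factors q s n * q ^ (s * (2 * n + 1)))
       = odd_factors q n * (\<Sum>j\<le>2 * n. q ^ (\<Sum>{..j}))"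
proof (induction n)
  case 0
  then show ?case by (simp add: odd_factors_def even_factors_def)
next
  case (Suc n)
  \<comment> \<open>For \<open>s \<le> n\<close> this is the \<open>s\<close>-th old term times \<open>1 - q^(2s)\<close>. At \<open>s = n + 1\<close> the even
    product would have to be the reciprocal of \<open>1 - q^(2n+2)\<close>, which cancels the factor \<open>1 - q^(2s)\<close>;
    the second branch is what remains.\<close>
  define G where "G s = (if s \<le> n then odd_factors q s * even_factors q s n * (1 - q ^ (2 * s)) * q ^ (s * (2 * n + 1))
      else odd_factors q (Suc n) * q ^ (Suc n * (2 * n + 1)))" for s
  have diff: "odd_factors q s * even_factors q s (Suc n) * q ^ (s * (2 * Suc n + 1))
      - (1 - q ^ (2 * n + 1)) * (odd_factors q s * even_factors q s n * q ^ (s * (2 * n + 1))) = G (Suc s) - G s"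
    if s: "s \<le> n" for s
  proof -
    have G1: "G (Suc s) = odd_factors q s * even_factors q s n * (1 - q ^ (2 * s + 1)) * q ^ (Suc s * (2 * n + 1))"
    proof (cases "s = n")
      case True
      then show ?thesis by (simp add: G_def odd_factors_def even_factors_same del: mult_Suc)
    next
      case False
      then have "s < n" using s by simp
      then show ?thesis
        by (simp add: G_def odd_factors_def even_factors_split_first[OF \<open>s < n\<close>] mult_ac del: mult_Suc)
    qed
    have p1: "q ^ (Suc s * (2 * n + 1)) = q ^ (s * (2 * n + 1)) * q ^ (2 * n + 1)"
      by (simp only: mult_Suc power_add mult.commute)
    have p: "q ^ (s * (2 * Suc n + 1)) = q ^ (s * (2 * n + 1)) * q ^ (2 * s)"
      by (simp add: power_add[symmetric] algebra_simps)
    \<comment> \<open>The regrouping that makes the difference telescope: the two products on the right are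
      what \<open>G (Suc s)\<close> and \<open>G s\<close> contribute.\<close>
    have c: "(1 - q ^ (2 * Suc n)) * q ^ (2 * s) - (1 - q ^ (2 * n + 1))
        = (1 - q ^ (2 * s + 1)) * q ^ (2 * n + 1) - (1 - q ^ (2 * s))"
      by (simp add: algebra_simps power_add power2_eq_square)
    have "odd_factors q s * even_factors q s (Suc n) * q ^ (s * (2 * Suc n + 1))
      - (1 - q ^ (2 * n + 1)) * (odd_factors q s * even_factors q s n * q ^ (s * (2 * n + 1)))
      = odd_factors q s * even_factors q s n * q ^ (s * (2 * n + 1))
        * ((1 - q ^ (2 * Suc n)) * q ^ (2 * s) - (1 - q ^ (2 * n + 1)))"
      unfolding p even_factors_Suc[OF s] by (simp only: algebra_simps)
    also have "\<dots> = G (Suc s) - G s"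
      unfolding c G1 p1 using s by (simp add: G_def) (simp only: algebra_simps)
    finally show ?thesis .
  qed
  have "(\<Sum>s\<le>n. odd_factors q s * even_factors q s (Suc n) * q ^ (s * (2 * Suc n + 1)))
      - (1 - q ^ (2 * n + 1)) * (\<Sum>s\<le>n. odd_factors q s * even_factors q s n * q ^ (s * (2 * n + 1)))
      = (\<Sum>s\<le>n. G (Suc s) - G s)"
    unfolding sum_distrib_left sum_subtractf[symmetric] by (rule sum.cong[OF refl]) (use diff in auto)
  also have "\<dots> = G (Suc n) - G 0"
    by (simp add: atMost_atLeast0 sum_Suc_diff)
  also have "\<dots> = odd_factors q (Suc n) * q ^ (\<Sum>{..2 * n + 1})"
  proof -
    have "\<Sum>{..2 * n + 1} = Suc n * (2 * n + 1)"
      by (induction n) (auto simp: algebra_simps)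
    then show ?thesis by (simp add: G_def)
  qed
  finally have main: "(\<Sum>s\<le>n. odd_factors q s * even_factors q s (Suc n) * q ^ (s * (2 * Suc n + 1)))
     = odd_factors q (Suc n) * (\<Sum>j\<le>2 * n. q ^ (\<Sum>{..j})) + odd_factors q (Suc n) * q ^ (\<Sum>{..2 * n + 1})"
    unfolding Suc.IH by (simp add: odd_factors_def algebra_simps)
  have "\<Sum>{..2 * Suc n} = Suc n * (2 * Suc n + 1)"
    by (induction n) (auto simp: algebra_simps)
  moreover have "{..2 * Suc n} = insert (2 * Suc n) (insert (2 * n + 1) {..2 * n})" by auto
  ultimately have "(\<Sum>j\<le>2 * Suc n. q ^ (\<Sum>{..j})) = q ^ (Suc n * (2 * Suc n + 1)) + (q ^ (\<Sum>{..2 * n + 1}) + (\<Sum>j\<le>2 * n. q ^ (\<Sum>{..j})))"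
    by (simp del: sum.atMost_Suc)
  then show ?case
    by (simp only: sum.atMost_Suc main even_factors_same) (simp only: distrib_left mult_1_right add_ac)
qed

lemma odd_times_even_factors:
  "odd_factors q n * even_factors q 0 n = (\<Prod>m\<in>{1..2 * n}. 1 - q ^ m)"
proof (induction n)
  case (Suc n)
  have "odd_factors q (Suc n) * even_factors q 0 (Suc n)
      = (odd_factors q n * even_factors q 0 n) * (1 - q ^ (2 * n + 1)) * (1 - q ^ (2 * Suc n))"
    by (simp only: even_factors_Suc[OF le0]) (simp add: odd_factors_def mult_ac)
  then show ?case unfolding Suc.IH by (simp add: mult_ac)
qed (simp add: odd_factors_def even_factors_def)

section \<open>Divisors and squares\<close>

text \<open>
  The map \<open>d \<mapsto> n div d\<close> exchanges the divisors below the square root of \<open>n\<close> with those above it, so the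
  parity is decided by the square root itself.
\<close>

lemma odd_card_divisors_iff:
  fixes n :: nat
  assumes "n > 0"
  shows "odd (card {d. d dvd n}) \<longleftrightarrow> (\<exists>s. n = s\<^sup>2)"
proof -
  let ?L = "{d. d dvd n \<and> d * d < n}" and ?E = "{d. d dvd n \<and> d * d = n}"
    and ?G = "{d. d dvd n \<and> d * d > n}"
  have fin: "finite {d. d dvd n}" using assms by simp
  have flip: "n div d * (n div d) < n \<longleftrightarrow> n < d * d" "n < n div d * (n div d) \<longleftrightarrow> d * d < n"
      "n div d dvd n" "n div (n div d) = d" if d: "d dvd n" for d
  proof -
    obtain e where e: "n = d * e" using d by (rule dvdE)
    with assms have "d > 0" "e > 0" by auto
    with e show "n div d * (n div d) < n \<longleftrightarrow> n < d * d" "n < n div d * (n div d) \<longleftrightarrow> d * d < n"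
      "n div d dvd n" "n div (n div d) = d" by auto
  qed
  have "bij_betw (\<lambda>d. n div d) ?L ?G"
    by (rule bij_betw_byWitness[where f' = "\<lambda>d. n div d"])
      (auto simp: flip)
  then have LG: "card ?L = card ?G" by (rule bij_betw_same_card)
  have "{d. d dvd n} = ?L \<union> (?E \<union> ?G)" by auto
  then have "card {d. d dvd n} = card (?L \<union> (?E \<union> ?G))" by (rule arg_cong)
  also have "\<dots> = card ?L + card (?E \<union> ?G)"
    by (rule card_Un_disjoint) (use fin in auto)
  also have "card (?E \<union> ?G) = card ?E + card ?G"
    by (rule card_Un_disjoint) (use fin in auto)
  finally have "odd (card {d. d dvd n}) \<longleftrightarrow> odd (card ?E)" unfolding LG by auto
  also have "\<dots> \<longleftrightarrow> (\<exists>s. n = s\<^sup>2)"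
  proof
    assume "odd (card ?E)"
    then have "?E \<noteq> {}" by (metis card.empty even_zero)
    then show "\<exists>s. n = s\<^sup>2" by (auto simp: power2_eq_square)
  next
    assume "\<exists>s. n = s\<^sup>2"
    then obtain s where "n = s * s" by (auto simp: power2_eq_square)
    then have "?E = {s}" by (auto simp flip: power2_eq_square)
    then show "odd (card ?E)" by simp
  qed
  finally show ?thesis .
qed


section \<open>Distinct parts plus a triangular number\<close>

text \<open>
  Polynomials without odd powers are closed under multiplication, and each factor is one of them.
\<close>

lemma coeff_odd_even_factors_square:
  assumes "odd N"
  shows "coeff (even_factors (monom (1::'a::comm_ring_1) 1) 0 n * even_factors (monom 1 1) 0 n) N = 0"
proof -
  have even_mult: "\<forall>i. odd i \<longrightarrow> coeff (p * p') i = 0"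
    if "\<forall>i. odd i \<longrightarrow> coeff p i = 0" "\<forall>i. odd i \<longrightarrow> coeff p' i = 0" for p p' :: "'a poly"
  proof (intro allI impI)
    fix i :: nat assume "odd i"
    have "coeff p j * coeff p' (i - j) = 0" if "j \<le> i" for j
      using that \<open>odd i\<close> \<open>\<forall>i. odd i \<longrightarrow> coeff p i = 0\<close> \<open>\<forall>i. odd i \<longrightarrow> coeff p' i = 0\<close>
      by (cases "odd j") auto
    then show "coeff (p * p') i = 0" by (simp add: coeff_mult)
  qed
  have "\<forall>i. odd i \<longrightarrow> coeff (even_factors (monom (1::'a) 1) 0 n) i = 0"
  proof (induction n)
    case 0
    then show ?case by (auto simp: even_factors_def odd_pos)
  next
    case (Suc n)
    have "coeff (1 - monom (1::'a) 1 ^ (2 * Suc n)) i = 0" if "odd i" for i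
      using that unfolding monom_power by (auto simp: odd_pos simp del: mult_Suc_right)
    then show ?case unfolding even_factors_Suc[OF le0] by (intro even_mult[OF Suc.IH]) blast
  qed
  then show ?thesis using even_mult assms by blast
qed

text \<open>
  Over the field with two elements \<open>1 - q^m\<close> is \<open>1 + q^m\<close>, so the product generates the sets of
  distinct parts taken from \<open>A\<close>.
\<close>

lemma prod_one_minus_eq_sum_subsets:
  "(\<Prod>m\<in>A. 1 - monom (1::bit) 1 ^ m) = (\<Sum>C\<in>Pow A. monom 1 (\<Sum>C))" if "finite A"
proof -
  have monom_prod: "(\<Prod>m\<in>C. monom (1::bit) m) = monom 1 (\<Sum>C)" for C
    by (induction C rule: infinite_finite_induct) (auto simp: mult_monom)
  have "1 - monom (1::bit) 1 ^ m = monom 1 m + 1" for m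
    by (rule poly_eqI) (simp add: monom_power add.commute)
  then have "(\<Prod>m\<in>A. 1 - monom (1::bit) 1 ^ m) = (\<Prod>m\<in>A. monom 1 m + 1)"
    by (simp only:)
  also have "\<dots> = (\<Sum>C\<in>Pow A. \<Prod>m\<in>C. monom 1 m)"
    using that by (simp add: prod_add)
  also have "\<dots> = (\<Sum>C\<in>Pow A. monom 1 (\<Sum>C))"
    by (simp only: monom_prod)
  finally show ?thesis .
qed

lemma le_sum_atMost: "j \<le> \<Sum>{..j}" for j :: nat
  by (induction j) auto

text \<open>
  Over the field with two elements the pairs \<open>(C, j)\<close> are counted by the coefficient of \<open>q^N\<close> in
  \<open>\<Prod>(1 - q^m)\<close> times the sum of the \<open>q^(\<Sum>{..j})\<close>. The product is that of the odd and the even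
  factors; the odd factors and the sum together are, by Gauss's identity, the even factors again up to
  multiples of \<open>q^(2N+1)\<close>. What remains is the square of a polynomial in \<open>q^2\<close>, and \<open>N\<close> is odd.
\<close>

lemma even_card_distinct_plus_triangular:
  fixes N :: nat
  assumes "odd N"
  shows "even (card {(C, j). finite C \<and> 0 \<notin> C \<and> \<Sum>C + \<Sum>{..j} = N})"
proof -
  let ?q = "monom (1::bit) 1"
  \<comment> \<open>Cutting off both components at \<open>2 * N\<close> loses no pair and matches the products with \<open>n = N\<close>.\<close>
  let ?S = "{x \<in> Pow {1..2 * N} \<times> {..2 * N}. \<Sum>(fst x) + \<Sum>{..snd x} = N}"
  have "{(C, j). finite C \<and> 0 \<notin> C \<and> \<Sum>C + \<Sum>{..j} = N} = ?S"
  proof -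
    have "m \<in> {1..2 * N}" if "finite C" "0 \<notin> C" "\<Sum>C + \<Sum>{..j} = N" "m \<in> C" for C j m
      using member_le_sum[of m C "\<lambda>x. x"] that by (cases m) (auto simp del: sum.atMost_Suc)
    moreover have "j \<le> 2 * N" if "\<Sum>C + \<Sum>{..j} = N" for C j
      using le_sum_atMost[of j] that by linarith
    ultimately show ?thesis by (auto intro: finite_subset)
  qed
  moreover have "of_nat (card ?S) = (0::bit)"
  proof -
    have "of_nat (card ?S) = (\<Sum>x\<in>Pow {1..2 * N} \<times> {..2 * N}. if \<Sum>(fst x) + \<Sum>{..snd x} = N then 1 else 0 :: bit)"
      by (simp add: sum.If_cases Int_def)
    also have "\<dots> = coeff (\<Sum>x\<in>Pow {1..2 * N} \<times> {..2 * N}. monom 1 (\<Sum>(fst x) + \<Sum>{..snd x})) N"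
      by (simp add: coeff_sum)
    also have "(\<Sum>x\<in>Pow {1..2 * N} \<times> {..2 * N}. monom 1 (\<Sum>(fst x) + \<Sum>{..snd x}))
        = (\<Sum>C\<in>Pow {1..2 * N}. monom (1::bit) (\<Sum>C)) * (\<Sum>j\<le>2 * N. ?q ^ (\<Sum>{..j}))"
      by (simp add: sum_product sum.cartesian_product mult_monom monom_power case_prod_unfold)
    also have "\<dots> = even_factors ?q 0 N * (odd_factors ?q N * (\<Sum>j\<le>2 * N. ?q ^ (\<Sum>{..j})))"
      by (simp only: prod_one_minus_eq_sum_subsets[symmetric] finite_atLeastAtMost odd_times_even_factors[symmetric])
        (simp only: mult_ac)
    also have "\<dots> = (\<Sum>s\<le>N. even_factors ?q 0 N * (odd_factors ?q s * even_factors ?q s N * ?q ^ (s * (2 * N + 1))))"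
      unfolding gauss_triangular_finite[symmetric] by (rule sum_distrib_left)
    also have "coeff \<dots> N = 0"
    proof -
      have "coeff (even_factors ?q 0 N * (odd_factors ?q s * even_factors ?q s N * ?q ^ (s * (2 * N + 1)))) N = 0" for s
      proof (cases s)
        case 0
        then show ?thesis
          using coeff_odd_even_factors_square[OF assms, of N, where 'a = bit] by (simp add: odd_factors_def)
      next
        case (Suc r)
        then have less: "N < s * (2 * N + 1)" by simp
        have "even_factors ?q 0 N * (odd_factors ?q s * even_factors ?q s N * ?q ^ (s * (2 * N + 1)))
            = monom 1 (s * (2 * N + 1)) * (even_factors ?q 0 N * (odd_factors ?q s * even_factors ?q s N))"
          by (simp add: monom_power mult_ac)
        then show ?thesis using less by (simp only: coeff_monom_mult if_True)
      qed
      then show ?thesis by (simp only: coeff_sum sum.neutral_const)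
    qed
    finally show ?thesis .
  qed
  then have "even (of_nat (card ?S) :: bit)" by (simp only: dvd_0_right)
  then have "even (card ?S)" by (simp only: even_of_nat)
  ultimately show ?thesis by simp
qed

section \<open>Overpartitions grouped by their multiset of parts\<close>


lemma regular_non_overlined_iff:
  assumes "S \<subseteq> set_mset P"
  shows "regular l (non_overlined (P, S)) \<longleftrightarrow> (\<forall>m\<in>#P. l dvd m \<longrightarrow> count P m = 1 \<and> m \<in> S)"
proof -
  have fin: "finite S" using assms finite_subset by blast
  have "m \<in># P - mset_set S \<longleftrightarrow> m \<in># P \<and> \<not> (count P m = 1 \<and> m \<in> S)" for m
    using fin by (auto simp: in_diff_count count_mset_set' simp flip: count_greater_zero_iff)
  then show ?thesis by (auto simp: regular_def non_overlined_def)
qed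

text \<open>
  An admissible set of overlined sizes contains all multiples of \<open>l\<close> and an arbitrary set of the
  other sizes.
\<close>

lemma card_overlinings:
  "card {S. S \<subseteq> set_mset P \<and> regular l (non_overlined (P, S))}
     = (if \<forall>m\<in>#P. l dvd m \<longrightarrow> count P m = 1 then 2 ^ card {m \<in> set_mset P. \<not> l dvd m} else 0)"
proof (cases "\<forall>m\<in>#P. l dvd m \<longrightarrow> count P m = 1")
  case True
  let ?M = "{m \<in> set_mset P. l dvd m}" and ?U = "{m \<in> set_mset P. \<not> l dvd m}"
  have eq: "{S. S \<subseteq> set_mset P \<and> regular l (non_overlined (P, S))} = (\<lambda>U. ?M \<union> U) ` Pow ?U"
  proof (intro equalityI subsetI)
    fix S assume "S \<in> {S. S \<subseteq> set_mset P \<and> regular l (non_overlined (P, S))}"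
    then have "S \<subseteq> set_mset P" "?M \<subseteq> S" by (auto simp: regular_non_overlined_iff)
    then have "S = ?M \<union> (S \<inter> ?U)" by auto
    then show "S \<in> (\<lambda>U. ?M \<union> U) ` Pow ?U" by blast
  next
    fix S assume "S \<in> (\<lambda>U. ?M \<union> U) ` Pow ?U"
    then have "S \<subseteq> set_mset P" "?M \<subseteq> S" by auto
    then show "S \<in> {S. S \<subseteq> set_mset P \<and> regular l (non_overlined (P, S))}"
      using True by (auto simp: regular_non_overlined_iff)
  qed
  have "inj_on (\<lambda>U. ?M \<union> U) (Pow ?U)" by (auto simp: inj_on_def)
  then show ?thesis using True unfolding eq by (simp add: card_image card_Pow)
next
  case False
  then have empty: "{S. S \<subseteq> set_mset P \<and> regular l (non_overlined (P, S))} = {}"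
    by (auto simp: regular_non_overlined_iff)
  show ?thesis unfolding empty using False by auto
qed

lemma R_star_eq_sum:
  "R_star l n = (\<Sum>P\<in>partitions n. if \<forall>m\<in>#P. l dvd m \<longrightarrow> count P m = 1
     then 2 ^ card {m \<in> set_mset P. \<not> l dvd m} else 0)"
proof -
  have "{\<pi> \<in> overpartitions n. regular l (non_overlined \<pi>)}
      = (SIGMA P:partitions n. {S. S \<subseteq> set_mset P \<and> regular l (non_overlined (P, S))})"
    by (auto simp: overpartitions_def)
  moreover have "finite {S. S \<subseteq> set_mset P \<and> regular l (non_overlined (P, S))}" for P
    by (rule finite_subset[of _ "Pow (set_mset P)"]) auto
  ultimately show ?thesis
    by (simp add: R_star_def card_SigmaI finite_partitions card_overlinings)
qed

section \<open>Reduction modulo 4 to squares\<close>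

text \<open>
  The multisets with exactly two admissible overlinings: the only part size whose overlining is not
  forced is the single one that is not a multiple of \<open>l\<close>.
\<close>

definition one_free_size :: "nat \<Rightarrow> nat \<Rightarrow> nat multiset set" where
  "one_free_size l n = {P \<in> partitions n. (\<forall>m\<in>#P. l dvd m \<longrightarrow> count P m = 1)
     \<and> card {m \<in> set_mset P. \<not> l dvd m} = 1}"

definition distinct_multiples :: "nat \<Rightarrow> nat \<Rightarrow> nat set set" where
  "distinct_multiples l n = {B. finite B \<and> 0 \<notin> B \<and> (\<forall>b\<in>B. l dvd b) \<and> \<Sum>B \<le> n}"

lemma finite_distinct_multiples: "finite (distinct_multiples l n)"
proof (rule finite_subset)
  show "distinct_multiples l n \<subseteq> Pow {..n}"
  proof
    fix B assume "B \<in> distinct_multiples l n"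
    then have B: "finite B" "\<Sum>B \<le> n" by (auto simp: distinct_multiples_def)
    have "m \<le> n" if "m \<in> B" for m
      using member_le_sum[of m B "\<lambda>x. x"] that B by simp
    then show "B \<in> Pow {..n}" by auto
  qed
qed simp

text \<open>
  Since \<open>l\<close> does not divide \<open>n\<close>, some part is not a multiple of \<open>l\<close>. So each nonzero summand
  \<open>2 ^ c\<close> in \<open>R_star_eq_sum\<close> has \<open>c \<ge> 1\<close>, and it vanishes modulo 4 unless \<open>c = 1\<close>.
\<close>

lemma R_star_cong_one_free_size:
  assumes "\<not> l dvd n"
  shows "[R_star l n = 2 * card (one_free_size l n)] (mod 4)"
proof -
  have "[(if \<forall>m\<in>#P. l dvd m \<longrightarrow> count P m = 1 then 2 ^ card {m \<in> set_mset P. \<not> l dvd m} else 0)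
      = (if P \<in> one_free_size l n then 2 else 0)] (mod (4::nat))" if P: "P \<in> partitions n" for P
  proof -
    let ?c = "card {m \<in> set_mset P. \<not> l dvd m}"
    have "{m \<in> set_mset P. \<not> l dvd m} \<noteq> {}"
    proof
      assume "{m \<in> set_mset P. \<not> l dvd m} = {}"
      then have "\<forall>m\<in>#P. l dvd m" by blast
      then have "l dvd \<Sum>\<^sub># P" by (induction P) auto
      with P assms show False by (simp add: partitions_def)
    qed
    then have "?c \<noteq> 0" by simp
    moreover have "[2 ^ ?c = 0] (mod (4::nat))" if "?c \<ge> 2"
      using le_imp_power_dvd[OF that, of "2::nat"] by (simp add: cong_0_iff)
    moreover have "P \<in> one_free_size l n \<longleftrightarrow> (\<forall>m\<in>#P. l dvd m \<longrightarrow> count P m = 1) \<and> ?c = 1"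
      using P by (simp add: one_free_size_def)
    moreover have "?c = 1 \<or> ?c \<ge> 2" using \<open>?c \<noteq> 0\<close> by linarith
    ultimately show ?thesis by (elim disjE) auto
  qed
  then have "[R_star l n = (\<Sum>P\<in>partitions n. if P \<in> one_free_size l n then 2 else 0)] (mod 4)"
    unfolding R_star_eq_sum by (rule cong_sum)
  also have "(\<Sum>P\<in>partitions n. if P \<in> one_free_size l n then 2 else 0 :: nat) = 2 * card (one_free_size l n)"
  proof -
    have "partitions n \<inter> {P. P \<in> one_free_size l n} = one_free_size l n" by (auto simp: one_free_size_def)
    then show ?thesis by (simp add: sum.If_cases finite_partitions)
  qed
  finally show ?thesis .
qed

text \<open>
  The multisets on the left are the disjoint unions of a set \<open>B\<close> of multiples of \<open>l\<close> and \<open>k > 0\<close> copies of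
  a size \<open>a\<close> with \<open>k * a = n - \<Sum>B\<close>. Every divisor \<open>a\<close> is allowed: a multiple of \<open>l\<close> cannot divide
  \<open>n - \<Sum>B\<close>, as \<open>l\<close> divides \<open>\<Sum>B\<close> but not \<open>n\<close>.
\<close>

lemma card_one_free_size:
  assumes "\<not> l dvd n"
  shows "card (one_free_size l n) = (\<Sum>B\<in>distinct_multiples l n. card {a. a dvd n - \<Sum>B})"
proof -
  define g where "g = (\<lambda>(B :: nat set, a). mset_set B + replicate_mset ((n - \<Sum>B) div a) a)"
  let ?D = "SIGMA B:distinct_multiples l n. {a. a dvd n - \<Sum>B}"
  have rest: "\<not> l dvd n - \<Sum>B" "n - \<Sum>B > 0" if "B \<in> distinct_multiples l n" for B
  proof -
    have "l dvd \<Sum>B" using that by (auto simp: distinct_multiples_def intro: dvd_sum)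
    moreover have "n = \<Sum>B + (n - \<Sum>B)" using that by (simp add: distinct_multiples_def)
    ultimately show "\<not> l dvd n - \<Sum>B" using assms by (metis dvd_add)
    then show "n - \<Sum>B > 0" by (cases "n - \<Sum>B") auto
  qed
  have g: "\<not> l dvd a" "a \<notin> B" "a > 0" "set_mset (g (B, a)) = insert a B" "\<forall>m\<in>B. count (g (B, a)) m = 1"
      "\<Sum>\<^sub># (g (B, a)) = n" if "(B, a) \<in> ?D" for B a
  proof -
    have B: "B \<in> distinct_multiples l n" and a: "a dvd n - \<Sum>B" using that by auto
    then show na: "\<not> l dvd a" using rest(1) dvd_trans by blast
    then show aB: "a \<notin> B" using B by (auto simp: distinct_multiples_def)
    show "a > 0" using a rest(2)[OF B] by (cases a) auto
    then have "(n - \<Sum>B) div a > 0"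
      using a rest(2)[OF B] by (simp add: div_greater_zero_iff dvd_imp_le)
    then show "set_mset (g (B, a)) = insert a B"
      using B by (auto simp: g_def distinct_multiples_def)
    show "\<forall>m\<in>B. count (g (B, a)) m = 1"
      using B aB by (auto simp: g_def distinct_multiples_def)
    show "\<Sum>\<^sub># (g (B, a)) = n"
      using B a by (simp add: g_def distinct_multiples_def sum_unfold_sum_mset)
  qed
  have split: "{m \<in> set_mset (g (B, a)). l dvd m} = B" "{m \<in> set_mset (g (B, a)). \<not> l dvd m} = {a}"
    if "(B, a) \<in> ?D" for B a
  proof -
    have "\<forall>b\<in>B. l dvd b" using that by (auto simp: distinct_multiples_def)
    then show "{m \<in> set_mset (g (B, a)). l dvd m} = B" "{m \<in> set_mset (g (B, a)). \<not> l dvd m} = {a}"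
      unfolding g(4)[OF that] using g(1)[OF that] by auto
  qed
  have "inj_on g ?D"
  proof (rule inj_onI)
    fix x y assume xy: "x \<in> ?D" "y \<in> ?D" "g x = g y"
    obtain B a C b where [simp]: "x = (B, a)" "y = (C, b)" by fastforce
    have eq: "g (B, a) = g (C, b)" and D: "(B, a) \<in> ?D" "(C, b) \<in> ?D" using xy by auto
    have "B = C" using split(1)[OF D(1)] split(1)[OF D(2)] unfolding eq by (rule trans[OF sym])
    moreover have "{a} = {b}" using split(2)[OF D(1)] split(2)[OF D(2)] unfolding eq by (rule trans[OF sym])
    ultimately show "x = y" by simp
  qed
  moreover have "g ` ?D = one_free_size l n"
  proof (intro equalityI subsetI)
    fix P assume "P \<in> g ` ?D"
    then obtain B a where Ba: "(B, a) \<in> ?D" and P: "P = g (B, a)" by auto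
    then have "0 \<notin> B" by (auto simp: distinct_multiples_def)
    then show "P \<in> one_free_size l n"
      using g[OF Ba] split[OF Ba] by (auto simp: one_free_size_def partitions_def P)
  next
    fix P assume P: "P \<in> one_free_size l n"
    then obtain a where a: "{m \<in> set_mset P. \<not> l dvd m} = {a}"
      by (auto simp: one_free_size_def card_1_singleton_iff)
    define B where "B = {m \<in> set_mset P. l dvd m}"
    have Peq: "P = mset_set B + replicate_mset (count P a) a"
    proof (rule multiset_eqI)
      fix m
      have "m \<in> B \<longleftrightarrow> m \<in># P \<and> m \<noteq> a" "a \<notin> B" using a by (auto simp: B_def)
      moreover have "finite B" by (simp add: B_def)
      ultimately show "count P m = count (mset_set B + replicate_mset (count P a) a) m"
        using P by (auto simp: one_free_size_def count_mset_set' B_def not_in_iff)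
    qed
    have n: "n = \<Sum>B + count P a * a"
      using P arg_cong[OF Peq, of sum_mset] by (simp add: one_free_size_def partitions_def sum_unfold_sum_mset)
    have "0 \<notin># P" using P by (simp add: one_free_size_def partitions_def)
    moreover have "a \<in># P" using a by blast
    ultimately have "a \<noteq> 0" by metis
    have rest: "n - \<Sum>B = count P a * a" "\<Sum>B \<le> n" using n by linarith+
    have "P = g (B, a)" using Peq rest(1) \<open>a \<noteq> 0\<close> by (simp add: g_def)
    moreover have "B \<in> distinct_multiples l n"
      using rest(2) \<open>0 \<notin># P\<close> by (simp add: distinct_multiples_def B_def)
    then have "(B, a) \<in> ?D" using rest(1) by simp
    ultimately show "P \<in> g ` ?D" by blast
  qed
  ultimately have "card (one_free_size l n) = card ?D"
    by (metis card_image)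
  also have "\<dots> = (\<Sum>B\<in>distinct_multiples l n. card {a. a dvd n - \<Sum>B})"
    using rest by (intro card_SigmaI finite_distinct_multiples) auto
  finally show ?thesis .
qed

lemma even_card_one_free_size_iff:
  assumes "\<not> l dvd n"
  shows "even (card (one_free_size l n))
    \<longleftrightarrow> even (card {B. finite B \<and> 0 \<notin> B \<and> (\<forall>b\<in>B. l dvd b) \<and> (\<exists>s. \<Sum>B + s\<^sup>2 = n)})"
proof -
  have eq: "{B \<in> distinct_multiples l n. odd (card {a. a dvd n - \<Sum>B})}
      = {B. finite B \<and> 0 \<notin> B \<and> (\<forall>b\<in>B. l dvd b) \<and> (\<exists>s. \<Sum>B + s\<^sup>2 = n)}"
  proof -
    have "odd (card {a. a dvd n - \<Sum>B}) \<longleftrightarrow> (\<exists>s. \<Sum>B + s\<^sup>2 = n)" if B: "B \<in> distinct_multiples l n" for B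
    proof -
      have "l dvd \<Sum>B" using B by (auto simp: distinct_multiples_def intro: dvd_sum)
      then have "\<Sum>B < n" using B assms by (auto simp: distinct_multiples_def le_less)
      then have "n - \<Sum>B = s\<^sup>2 \<longleftrightarrow> \<Sum>B + s\<^sup>2 = n" for s by auto
      with \<open>\<Sum>B < n\<close> show ?thesis by (simp add: odd_card_divisors_iff)
    qed
    then have "{B \<in> distinct_multiples l n. odd (card {a. a dvd n - \<Sum>B})}
        = {B \<in> distinct_multiples l n. \<exists>s. \<Sum>B + s\<^sup>2 = n}" by blast
    also have "\<dots> = {B. finite B \<and> 0 \<notin> B \<and> (\<forall>b\<in>B. l dvd b) \<and> (\<exists>s. \<Sum>B + s\<^sup>2 = n)}"
    proof -
      have "\<Sum>B \<le> n" if "\<exists>s. \<Sum>B + s\<^sup>2 = n" for B using that le_add1 by metis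
      then show ?thesis unfolding distinct_multiples_def by blast
    qed
    finally show ?thesis .
  qed
  show ?thesis
    unfolding card_one_free_size[OF assms] eq[symmetric]
    by (rule even_sum_iff[OF finite_distinct_multiples])
qed

text \<open>
  The number of sets \<open>B\<close> on the right has the parity of half of \<open>R_star l n\<close>: it counts the \<open>B\<close> for
  which \<open>n - \<Sum>B\<close> has an odd number of divisors.
\<close>

lemma R_star_cong_0_iff:
  assumes "\<not> l dvd n"
  shows "[R_star l n = 0] (mod 4)
    \<longleftrightarrow> even (card {B. finite B \<and> 0 \<notin> B \<and> (\<forall>b\<in>B. l dvd b) \<and> (\<exists>s. \<Sum>B + s\<^sup>2 = n)})"
proof -
  have "[R_star l n = 0] (mod 4) \<longleftrightarrow> 4 dvd 2 * card (one_free_size l n)"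
    using R_star_cong_one_free_size[OF assms] by (metis cong_0_iff cong_dvd_iff)
  also have "\<dots> \<longleftrightarrow> even (card (one_free_size l n))" by presburger
  finally show ?thesis using even_card_one_free_size_iff[OF assms] by simp
qed

section \<open>The case of 8-regular non-overlined parts\<close>

text \<open>
  Here there are no sets \<open>B\<close> to count, since \<open>\<Sum>B\<close> is a multiple of 8 and squares are 0, 1 or 4
  modulo 8.
\<close>

lemma R_star_8_cong_0_if_mod_8:
  assumes "n mod 8 \<notin> {0, 1, 4}"
  shows "[R_star 8 n = 0] (mod 4)"
proof -
  have "\<Sum>B + s\<^sup>2 \<noteq> n" if "\<forall>b\<in>B. 8 dvd b" for B and s :: nat
  proof
    assume n: "\<Sum>B + s\<^sup>2 = n"
    have "8 dvd \<Sum>B" using that by (auto intro: dvd_sum)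
    then have "n mod 8 = s\<^sup>2 mod 8" unfolding n[symmetric] by (auto elim!: dvdE)
    also have "\<dots> = (s mod 8)\<^sup>2 mod 8" by (simp add: power_mod)
    finally have nm: "n mod 8 = (s mod 8)\<^sup>2 mod 8" .
    have "s mod 8 \<in> {..<8}" by simp
    also have "{..<8::nat} = {0,1,2,3,4,5,6,7}" by auto
    finally show False using nm assms by auto
  qed
  then have empty: "{B. finite B \<and> 0 \<notin> B \<and> (\<forall>b\<in>B. 8 dvd b) \<and> (\<exists>s. \<Sum>B + s\<^sup>2 = n)} = {}" by blast
  have "\<not> 8 dvd n" using assms by auto
  then show ?thesis by (subst R_star_cong_0_iff) (simp_all only: empty card.empty even_zero not_False_eq_True)
qed

lemma square_eq_triangular: "(2 * j + 1)\<^sup>2 = 8 * \<Sum>{..j} + (1::nat)"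
  by (induction j) (auto simp: power2_eq_square algebra_simps)

text \<open>
  Writing \<open>B = 8 C\<close> and the odd square as \<open>(2 j + 1)^2 = 8 \<Sum>{..j} + 1\<close> turns \<open>\<Sum>B + s^2 = n\<close> into
  \<open>\<Sum>C + \<Sum>{..j} = (n - 1) / 8\<close>, whose right-hand side is odd because \<open>n mod 16 = 9\<close>.
\<close>

lemma R_star_8_cong_0_if_mod_16:
  assumes "n mod 16 = 9"
  shows "[R_star 8 n = 0] (mod 4)"
proof -
  define N where "N = n div 8"
  have N: "n = 8 * N + 1" "odd N" unfolding N_def using assms by presburger+
  let ?L = "{(C, j). finite C \<and> 0 \<notin> C \<and> \<Sum>C + \<Sum>{..j} = N}"
  let ?R = "{B. finite B \<and> 0 \<notin> B \<and> (\<forall>b\<in>B. 8 dvd b) \<and> (\<exists>s. \<Sum>B + s\<^sup>2 = n)}"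
  define f :: "nat set \<times> nat \<Rightarrow> nat set" where "f = (\<lambda>(C, j). (\<lambda>c. 8 * c) ` C)"
  have sum8: "\<Sum>((\<lambda>c. 8 * c) ` C) = 8 * \<Sum>C" for C :: "nat set"
    by (subst sum.reindex) (auto simp: inj_on_def sum_distrib_left)
  have "inj_on f ?L"
  proof (rule inj_onI)
    fix x y assume xy: "x \<in> ?L" "y \<in> ?L" "f x = f y"
    obtain C j D k where [simp]: "x = (C, j)" "y = (D, k)" by fastforce
    have "C = D" using xy(3) by (simp add: f_def inj_image_eq_iff inj_on_def)
    with xy have "\<Sum>{..j} = \<Sum>{..k}" by auto
    then have "(2 * j + 1)\<^sup>2 = (2 * k + 1)\<^sup>2" by (simp only: square_eq_triangular)
    then have "j = k" by simp
    with \<open>C = D\<close> show "x = y" by simp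
  qed
  moreover have "f ` ?L = ?R"
  proof (intro equalityI subsetI)
    fix B assume "B \<in> f ` ?L"
    then obtain C j where Cj: "finite C" "0 \<notin> C" "\<Sum>C + \<Sum>{..j} = N" "B = (\<lambda>c. 8 * c) ` C"
      by (auto simp: f_def)
    have "\<Sum>B + (2 * j + 1)\<^sup>2 = n"
      using Cj unfolding N square_eq_triangular Cj(4) sum8 by simp
    then show "B \<in> ?R" using Cj by auto
  next
    fix B assume "B \<in> ?R"
    then obtain s where B: "finite B" "0 \<notin> B" "\<forall>b\<in>B. 8 dvd b" "\<Sum>B + s\<^sup>2 = n" by auto
    define C where "C = (\<lambda>b. b div 8) ` B"
    have BC: "B = (\<lambda>c. 8 * c) ` C"
      using B(3) by (force simp: C_def image_image)
    have eq: "8 * \<Sum>C + s\<^sup>2 = 8 * N + 1" using B(4) unfolding N BC sum8 .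
    have "odd (8 * \<Sum>C + s\<^sup>2)" unfolding eq by simp
    then have "odd s" by simp
    then obtain j where j: "s = 2 * j + 1" by (elim oddE)
    have "\<Sum>C + \<Sum>{..j} = N" using eq unfolding j square_eq_triangular by simp
    moreover have "finite C" using B(1) unfolding C_def by (rule finite_imageI)
    moreover have "0 \<notin> C"
    proof
      assume "0 \<in> C"
      then have "8 * 0 \<in> B" unfolding BC by (rule imageI)
      with B(2) show False by simp
    qed
    ultimately have "(C, j) \<in> ?L" by simp
    moreover have "B = f (C, j)" unfolding f_def BC by simp
    ultimately show "B \<in> f ` ?L" by (rule rev_image_eqI)
  qed
  ultimately have "bij_betw f ?L ?R" by (simp only: bij_betw_def)
  then have "card ?L = card ?R" by (rule bij_betw_same_card)
  moreover have "even (card ?L)" using N(2) by (rule even_card_distinct_plus_triangular)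
  ultimately have "even (card ?R)" by (simp only:)
  moreover have "\<not> 8 dvd n" using assms by presburger
  ultimately show ?thesis using R_star_cong_0_iff by blast
qed

text \<open>
  The residues modulo 8 are 2, 3, 6, 7 in the first part and 5 for \<open>\<xi> = 1, 3\<close> in the second;
  for \<open>\<xi> = 2\<close> the residue modulo 16 is 9.
\<close>

theorem theorem3p5:
  fixes n :: nat
  shows "(\<forall>\<xi> \<in> {2, 3}. [R_star 8 (4 * n + \<xi>) = 0] (mod 4)) \<and>
         (\<forall>\<xi> \<in> {1, 2, 3}. [R_star 8 (16 * n + 4 * \<xi> + 1) = 0] (mod 4))"
proof (intro conjI ballI)
  fix \<xi> :: nat assume "\<xi> \<in> {2, 3}"
  then have "(4 * n + \<xi>) mod 8 \<notin> {0, 1, 4}" by (auto; presburger)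
  then show "[R_star 8 (4 * n + \<xi>) = 0] (mod 4)" by (rule R_star_8_cong_0_if_mod_8)
next
  fix \<xi> :: nat assume \<xi>: "\<xi> \<in> {1, 2, 3}"
  show "[R_star 8 (16 * n + 4 * \<xi> + 1) = 0] (mod 4)"
  proof (cases "\<xi> = 2")
    case True
    then show ?thesis by (intro R_star_8_cong_0_if_mod_16) simp
  next
    case False
    with \<xi> have "(16 * n + 4 * \<xi> + 1) mod 8 = 5" by (auto; presburger)
    then show ?thesis by (intro R_star_8_cong_0_if_mod_8) simp
  qed
qed

end
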